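(* Let $f\colon\mathbb{R}^n\to\mathbb{R}^n$, $g\colon\mathbb{R}^n\to\mathbb{R}^{n,m'}$, $h\colon\mathbb{R}^n\to\mathbb{R}^{m'}$ be continuous with $f(0)=0$, and let the system $\dot z=f(z)+g(z)u$, $y=h(z)$ be passive with continuously differentiable storage function $\mathcal{H}\colon\mathbb{R}^n\to\mathbb{R}_{\ge0}$. Let time points $0=t_1<\dots<t_m=T$ and a control $u\colon[0,T]\to\mathbb{R}^{m'}$ be given and define $\overline g(z_1,z_2):=g\big(\tfrac{z_1+z_2}{2}\big)$ for $z_1,z_2\in\mathbb{R}^n$ as well as $\overline u_i:=\tfrac{u(t_i)+u(t_{i+1})}{2}$ for $i=1,\dots,m-1$. Further, assume that $r\colon\mathbb{R}^n\to\mathbb{R}^n$ satisfies $$f(z)=-r(\nabla\mathcal{H}(z)),\qquad v^{\mathsf T}r(v)\ge0\qquad\text{for all }z,v\in\mathbb{R}^n.$$ Let $\overline\nabla\mathcal{H}$ denote the Gonzalez discrete gradient of $\mathcal{H}$ (see context). Then a solution $(z_i)_{i=1}^m$ of the time-discrete system $$z_{i+1}=z_i-(t_{i+1}-t_i)\,r\big(\overline\nabla\mathcal{H}(z_i,z_{i+1})\big)+(t_{i+1}-t_i)\,\overline g(z_i,z_{i+1})\,\overline u_i,\qquad i=1,\dots,m-1,$$ satisfies the time-discrete power balance and dissipation inequality $$\frac{\mathcal{H}(z_{i+1})-\mathcal{H}(z_i)}{t_{i+1}-t_i}=-\overline\nabla\mathcal{H}(z_i,z_{i+1})^{\mathsf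 T}r\big(\overline\nabla\mathcal{H}(z_i,z_{i+1})\big)+\overline y_i^{\mathsf T}\overline u_i\le\overline y_i^{\mathsf T}\overline u_i,$$ where the discrete output is $\overline y_i:=\overline g(z_i,z_{i+1})^{\mathsf T}\overline\nabla\mathcal{H}(z_i,z_{i+1})$, $i=1,\dots,m-1$.
   Context: A system $\dot z=f(z)+g(z)u$, $y=h(z)$ is passive with storage function $\mathcal{H}\ge0$ if $\mathcal{H}(z(t_1))-\mathcal{H}(z(t_0))\le\int_{t_0}^{t_1}y^{\mathsf T}u\,\mathrm{d}t$ for all $t_1\ge t_0\ge0$ and all controls $u$ along solutions. The Gonzalez discrete gradient $\overline\nabla\mathcal{H}\colon\mathbb{R}^n\times\mathbb{R}^n\to\mathbb{R}^n$ of $\mathcal{H}$ is defined by $$\overline\nabla\mathcal{H}(z_1,z_2)=\nabla\mathcal{H}\Big(\frac{z_1+z_2}{2}\Big)+\frac{\mathcal{H}(z_2)-\mathcal{H}(z_1)-\nabla\mathcal{H}\big(\frac{z_1+z_2}{2}\big)^{\mathsf T}(z_2-z_1)}{\|z_2-z_1\|^2}(z_2-z_1)\quad\text{if }z_1\ne z_2,$$ and $\overline\nabla\mathcal{H}(z_1,z_1)=\nabla\mathcal{H}(z_1)$, where $\|\cdot\|$ is the Euclidean norm. *)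

theory Defs
  imports "HOL-Analysis.Analysis"
begin

definition gradient :: "('a::euclidean_space \<Rightarrow> real) \<Rightarrow> 'a \<Rightarrow> 'a"
  where "gradient H z = (THE D. GDERIV H z :> D)"

lemma gradient_eq:
  assumes "GDERIV H z :> D"
  shows "gradient H z = D"
  unfolding gradient_def
proof (rule the_equality)
  show "GDERIV H z :> D" by (fact assms)
next
  fix D' assume "GDERIV H z :> D'"
  then have "(\<lambda>x. x \<bullet> D') = (\<lambda>x. x \<bullet> D)"
    using assms has_derivative_unique unfolding gderiv_def by blast
  then show "D' = D"
    by (simp add: fun_eq_iff vector_eq_ldot)
qed

lemma GDERIV_gradient:
  assumes "H differentiable (at z)"
  shows "GDERIV H z :> gradient H z"
proof -
  from assms obtain H' where H': "(H has_derivative H') (at z)"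
    by (auto simp: differentiable_def)
  then have "linear H'"
    by (rule has_derivative_linear)
  then have "H' = (\<lambda>x. x \<bullet> adjoint H' 1)"
    using adjoint_works[of H' _ 1] by (intro ext) simp
  with H' have "GDERIV H z :> adjoint H' 1"
    by (simp add: gderiv_def)
  then show ?thesis
    by (simp add: gradient_eq)
qed

definition continuously_differentiable :: "('a::euclidean_space \<Rightarrow> real) \<Rightarrow> bool"
  where "continuously_differentiable H \<longleftrightarrow>
    (\<forall>z. H differentiable (at z)) \<and> continuous_on UNIV (gradient H)"

text \<open>
  Solutions are Caratheodory solutions: the control is Lebesgue integrable on the time interval
  and the state is continuous and satisfies the integrated form of
  \<open>z' = f(z) + g(z) u\<close>.  For continuous \<open>f\<close> and \<open>g\<close> this makes \<open>z\<close> absolutely continuous,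
  and for continuous controls it gives exactly the classical solutions.  Solutions are only
  required to exist on the interval under consideration, since they may blow up in finite time.
\<close>

definition controlled_solution ::
    "(real^'n \<Rightarrow> real^'n) \<Rightarrow> (real^'n \<Rightarrow> real^'m^'n) \<Rightarrow> (real \<Rightarrow> real^'m) \<Rightarrow>
      (real \<Rightarrow> real^'n) \<Rightarrow> real \<Rightarrow> real \<Rightarrow> bool"
  where "controlled_solution f g u z t\<^sub>0 t\<^sub>1 \<longleftrightarrow>
    u absolutely_integrable_on {t\<^sub>0..t\<^sub>1} \<and>
    continuous_on {t\<^sub>0..t\<^sub>1} z \<and>
    (\<forall>t\<in>{t\<^sub>0..t\<^sub>1}.
      ((\<lambda>s. f (z s) + g (z s) *v u s) has_integral (z t - z t\<^sub>0)) {t\<^sub>0..t})"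

definition passive_system ::
    "(real^'n \<Rightarrow> real^'n) \<Rightarrow> (real^'n \<Rightarrow> real^'m^'n) \<Rightarrow> (real^'n \<Rightarrow> real^'m) \<Rightarrow>
      (real^'n \<Rightarrow> real) \<Rightarrow> bool"
  where "passive_system f g h H \<longleftrightarrow>
    (\<forall>z. 0 \<le> H z) \<and>
    (\<forall>t\<^sub>0 t\<^sub>1 u z. 0 \<le> t\<^sub>0 \<longrightarrow> t\<^sub>0 \<le> t\<^sub>1 \<longrightarrow> controlled_solution f g u z t\<^sub>0 t\<^sub>1 \<longrightarrow>
      H (z t\<^sub>1) - H (z t\<^sub>0) \<le> integral {t\<^sub>0..t\<^sub>1} (\<lambda>t. h (z t) \<bullet> u t))"

definition gonzalez_gradient :: "('a::euclidean_space \<Rightarrow> real) \<Rightarrow> 'a \<Rightarrow> 'a \<Rightarrow> 'a"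
  where "gonzalez_gradient H z\<^sub>1 z\<^sub>2 =
    (if z\<^sub>1 = z\<^sub>2 then gradient H z\<^sub>1
     else gradient H (midpoint z\<^sub>1 z\<^sub>2) +
       ((H z\<^sub>2 - H z\<^sub>1 - gradient H (midpoint z\<^sub>1 z\<^sub>2) \<bullet> (z\<^sub>2 - z\<^sub>1)) / (norm (z\<^sub>2 - z\<^sub>1))\<^sup>2)
         *\<^sub>R (z\<^sub>2 - z\<^sub>1))"

definition gbar :: "(real^'n \<Rightarrow> real^'m^'n) \<Rightarrow> real^'n \<Rightarrow> real^'n \<Rightarrow> real^'m^'n"
  where "gbar g z\<^sub>1 z\<^sub>2 = g (midpoint z\<^sub>1 z\<^sub>2)"

definition ubar :: "(nat \<Rightarrow> real) \<Rightarrow> (real \<Rightarrow> real^'m) \<Rightarrow> nat \<Rightarrow> real^'m"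
  where "ubar t u i = midpoint (u (t i)) (u (t (i + 1)))"

definition ybar ::
    "(real^'n \<Rightarrow> real^'m^'n) \<Rightarrow> (real^'n \<Rightarrow> real) \<Rightarrow> (nat \<Rightarrow> real^'n) \<Rightarrow> nat \<Rightarrow> real^'m"
  where "ybar g H z i =
    transpose (gbar g (z i) (z (i + 1))) *v gonzalez_gradient H (z i) (z (i + 1))"

end

theory Submission
  imports Defs
begin

text \<open>The correction term of the Gonzalez gradient is scaled so that a discrete chain rule
  holds exactly: pairing it with the increment of the state gives the increment of \<open>H\<close>
  (\<open>gonzalez_gradient_inner_diff\<close>). Inserting the increment prescribed by the scheme
  splits the change of energy into a dissipated part, in which \<open>r\<close> is paired with its
  own argument and so has a sign, and an input part. The latter becomes supplied power once
  \<open>gbar\<close> is moved to the other side of the inner product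
  (\<open>transpose_matrix_vector_inner\<close>).\<close>

lemma gonzalez_gradient_inner_diff:
  "gonzalez_gradient H x y \<bullet> (y - x) = H y - H x"
  \<comment> \<open>For \<open>x = y\<close> both sides vanish. Otherwise the squared norm cancels,
    and the two midpoint slopes cancel each other.\<close>
  by (cases "x = y")
    (simp_all add: gonzalez_gradient_def inner_add_left power2_norm_eq_inner)

lemma transpose_matrix_vector_inner:
  fixes A :: "real^'m^'n"
  shows "(transpose A *v v) \<bullet> w = v \<bullet> (A *v w)"
  by (simp add: dot_lmul_matrix)

theorem theorem15:
  fixes f :: "real^'n \<Rightarrow> real^'n"
    and g :: "real^'n \<Rightarrow> real^'m^'n"
    and h :: "real^'n \<Rightarrow> real^'m"
    and H :: "real^'n \<Rightarrow> real"
    and r :: "real^'n \<Rightarrow> real^'n"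
    and T :: real
    and m :: nat
    and t :: "nat \<Rightarrow> real"
    and u :: "real \<Rightarrow> real^'m"
    and z :: "nat \<Rightarrow> real^'n"
  assumes "continuous_on UNIV f" and "continuous_on UNIV g" and "continuous_on UNIV h"
    and "f 0 = 0"
    and "continuously_differentiable H"
    and "passive_system f g h H"
    and "m \<ge> 1" and "t 1 = 0" and "t m = T" and "strict_mono_on {1..m} t"
    and "\<And>x. f x = - r (gradient H x)"
    and "\<And>v. v \<bullet> r v \<ge> 0"
    and "\<And>i. i \<in> {1..m - 1} \<Longrightarrow>
      z (i + 1) = z i
        - (t (i + 1) - t i) *\<^sub>R r (gonzalez_gradient H (z i) (z (i + 1)))
        + (t (i + 1) - t i) *\<^sub>R (gbar g (z i) (z (i + 1)) *v ubar t u i)"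
  shows "\<forall>i\<in>{1..m - 1}.
    (H (z (i + 1)) - H (z i)) / (t (i + 1) - t i)
      = - (gonzalez_gradient H (z i) (z (i + 1)) \<bullet> r (gonzalez_gradient H (z i) (z (i + 1))))
        + ybar g H z i \<bullet> ubar t u i \<and>
    - (gonzalez_gradient H (z i) (z (i + 1)) \<bullet> r (gonzalez_gradient H (z i) (z (i + 1))))
        + ybar g H z i \<bullet> ubar t u i
      \<le> ybar g H z i \<bullet> ubar t u i"
proof
  fix i assume i: "i \<in> {1..m - 1}"
  define d where "d = t (i + 1) - t i"
  define G where "G = gonzalez_gradient H (z i) (z (i + 1))"
  \<comment> \<open>Both \<open>i\<close> and \<open>i + 1\<close> lie in \<open>{1..m}\<close>,
    where \<open>t\<close> is strictly increasing.\<close>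
  have "t i < t (i + 1)"
    using i by (intro strict_mono_onD[OF assms(10)]) auto
  then have d: "d > 0"
    by (simp add: d_def)
  have step: "z (i + 1) - z i
      = d *\<^sub>R (gbar g (z i) (z (i + 1)) *v ubar t u i - r G)"
    using assms(13)[OF i] unfolding d_def G_def by (simp add: algebra_simps)
  \<comment> \<open>The discrete chain rule turns the energy increment into a pairing with the state
    increment, which the scheme gives explicitly.\<close>
  have "H (z (i + 1)) - H (z i) = G \<bullet> (z (i + 1) - z i)"
    by (simp only: G_def gonzalez_gradient_inner_diff)
  also have "\<dots> = d * (G \<bullet> (gbar g (z i) (z (i + 1)) *v ubar t u i) - G \<bullet> r G)"
    by (simp only: step inner_scaleR_right inner_diff_right)
  \<comment> \<open>By its definition, \<open>ybar\<close> is exactly what the transpose of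
    \<open>gbar\<close> produces when applied to \<open>G\<close>.\<close>
  also have "\<dots> = d * (- (G \<bullet> r G) + ybar g H z i \<bullet> ubar t u i)"
    by (simp only: ybar_def G_def[symmetric] transpose_matrix_vector_inner) simp
  finally have "(H (z (i + 1)) - H (z i)) / d = - (G \<bullet> r G) + ybar g H z i \<bullet> ubar t u i"
    using d by (simp add: field_simps)
  \<comment> \<open>The sign condition on \<open>r\<close> holds at every vector, so it applies to
    \<open>G\<close> even if \<open>G\<close> is not a gradient of \<open>H\<close> at any
    point.\<close>
  moreover have "- (G \<bullet> r G) + ybar g H z i \<bullet> ubar t u i \<le> ybar g H z i \<bullet> ubar t u i"
    using assms(12)[of G] by simp
  ultimately show "(H (z (i + 1)) - H (z i)) / (t (i + 1) - t i)
      = - (gonzalez_gradient H (z i) (z (i + 1)) \<bullet> r (gonzalez_gradient H (z i) (z (i + 1))))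
        + ybar g H z i \<bullet> ubar t u i \<and>
    - (gonzalez_gradient H (z i) (z (i + 1)) \<bullet> r (gonzalez_gradient H (z i) (z (i + 1))))
        + ybar g H z i \<bullet> ubar t u i
      \<le> ybar g H z i \<bullet> ubar t u i"
    unfolding d_def G_def by blast
qed

end
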